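(* Let $G$ and $H$ be étale groupoids. Let $(X,\lambda)\colon G\to H$ be a proper topological correspondence. Then (i) for each $z\in H^{(0)}$, the measure $\lambda_z$ is atomic; (ii) for each $z\in H^{(0)}$, each atom in $\lambda_z$ is nonzero, and the function $\mathfrak D$ appearing in condition (iii) of the definition of a proper topological correspondence is positive. Thus the family of measures $\lambda$ has full support.
   Context: Étale groupoid: a topological groupoid $G$ whose range map $r_G$ is a local homeomorphism, whose unit space $G^{(0)}$ is a locally compact Hausdorff subspace, and which is covered by countably many compact (Hausdorff) sets whose interiors form a basis of the topology of $G$. It carries its canonical Haar system of counting measures on the fibres of $r_G$. Full support of $\lambda$ means $\mathrm{supp}(\lambda_z)=s_X^{-1}(z)$ for all $z\in H^{(0)}$. Conventions. "Compact" means quasi-compact and Hausdorff; a space is locally compact if every point has a compact neighbourhood. A map of locally compact spaces is proper if inverse images of quasi-compact sets are quasi-compact. Measures are positive, Radon and $\sigma$-finite. For a locally compact space $P$, $C_c(P)$ is the linear span of the functions obtained by extending by zero continuous compactly supported functions on open Hausdorff subsets of $P$. In the definitions below $(G,\alpha)$, $(H,\beta)$ are locally compact groupoids (locally compact arrow space, Hausdorff unit space) with Haar systems. For a left $G$-space $X$ with momentum map $r_X\colon X\to G^{(0)}$, put $G\times_{G^{(0)}}X=\{(\gamma,x): s_G(\gamma)=r_X(x)\}$, the arrow space of $G\ltimes X$. The momentum map of a right $H$-space is $s_X\colon X\to H^{(0)}$. A $G$-$H$-bispace carries commuting continuous left $G$- and right $H$-actions. The $H$-action is proper if $(x,\eta)\mapsto(x\eta,x)$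 into $X\times X$ is proper. Write $X\times_{s_X,H^{(0)},s_X}X=\{(x,y):s_X(x)=s_X(y)\}$ with the diagonal $H$-action. A continuous family of measures $\lambda=\{\lambda_u\}_{u\in H^{(0)}}$ along $s_X$ consists of measures $\lambda_u$ supported in $s_X^{-1}(u)$ with $u\mapsto\int f\,d\lambda_u$ continuous for $f\in C_c(X)$; it is proper if all $\lambda_u\neq0$, and $H$-invariant if $\int f(x\eta)\,d\lambda_{r_H(\eta)}(x)=\int f\,d\lambda_{s_H(\eta)}$ for all $\eta\in H$. Topological correspondence. A topological correspondence from $(G,\alpha)$ to $(H,\beta)$ is a pair $(X,\lambda)$ where $X$ is a locally compact $G$-$H$-bispace with proper $H$-action, $\lambda$ is an $H$-invariant proper continuous family of measures along $s_X$, and there is a continuous function $\Delta\colon G\ltimes X\to(0,\infty)$ with $$\int\!\!\int F(\gamma^{-1},x)\,d\alpha^{r_X(x)}(\gamma)\,d\lambda_u(x)=\int\!\!\int F(\gamma,\gamma^{-1}x)\,\Delta(\gamma,\gamma^{-1}x)\,d\alpha^{r_X(x)}(\gamma)\,d\lambda_u(x)$$ for all $u\in H^{(0)}$ and $F\in C_c(G\times_{G^{(0)}}X)$. Local homeomorphisms onto the image and extensions. A continuous map $\phi\colon P\to Q$ is open onto its image if $\phi(U)$ is open in $\phi(P)$ for all open $U\subseteq P$. $\phi^{\mathrm{Ho,Co}}$ is the collection of open $U\subseteq P$ with compact closure such that $\phi|_U$ and $\phi|_{\overline U}$ are homeomorphisms onto their images. An extension of an open $U\subseteq P$ via $\phi$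 is an open $U'\subseteq Q$ with $U'\cap\phi(P)=\phi(U)$. $C_c(P,U)$ is the set of $f\in C_c(P)$ with $\mathrm{supp}(f)\subseteq U$. For $f\in C_c(P,U)$, an extension $f'\in C_c(Q,U')$ of $f$ via $\phi$ (with $U'$ an extension of $U$) is one with $f'\circ\phi|_U=f$ on $U$. For an open cover $\mathcal A$ of $P$, an extension of $\mathcal A$ via $\phi$ is a collection $\mathcal A'$ of open subsets of $Q$ such that each $U'\in\mathcal A'$ either is an extension of some $U\in\mathcal A$ or satisfies $U'\cap\phi(P)=\emptyset$, and each $U\in\mathcal A$ has at least one extension in $\mathcal A'$. Proper topological correspondence. Let $m_{s_X}\colon G\times_{G^{(0)}}X\to X\times_{s_X,H^{(0)},s_X}X$, $m_{s_X}(\gamma,x)=(\gamma x,x)$. The left action is locally strongly locally free if for every $\gamma\in G$ and every $y\in r_X^{-1}(s_G(\gamma))$ there are neighbourhoods $U$ of $\gamma$ and $V$ of $y$ such that for $\delta,\eta\in U$ and $x\in V$, $\eta x=\delta x$ implies $\eta=\delta$. A topological correspondence $(X,\lambda)$ with $X$ Hausdorff and $X/H$ paracompact is proper if there is an $H$-invariant nonnegative continuous function $\mathfrak D\colon X\times_{s_X,H^{(0)},s_X}X\to\mathbb R$ such that: (i) the left $G$-action is locally strongly locally free and $m_{s_X}$ is open onto its image; (ii) the map $[r_X]\colon X/H\to G^{(0)}$ induced by $r_X$ is proper; (iii) there are an open cover $\mathcal A$ of $G\times_{G^{(0)}}X$ consisting of sets in $m_{s_X}^{\mathrm{Ho,Co}}$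 and an extension $\mathcal A'$ of $\mathcal A$ via $m_{s_X}$ such that for all $U\in\mathcal A$, every extension $U'\in\mathcal A'$ of $U$, every $f\in C_c(G\times_{G^{(0)}}X,U)$ and every extension $f'\in C_c(X\times_{s_X,H^{(0)},s_X}X,U')$ of $f$ via $m_{s_X}$, $$\int_X f'(x,y)\,\mathfrak D(x,y)\,d\lambda_{s_X(x)}(y)=\int_G f(\gamma,\gamma^{-1}x)\,d\alpha^{r_X(x)}(\gamma)\quad\text{for every }x\in X.$$
   Formalization: Positivity of 𝔇 is proved only at points (γx,x) of the image of m_{s_X}, not on all of X×_{s_X,H^(0),s_X}X; globally it fails, e.g. for trivial G and H, two-point discrete X with counting measure, and 𝔇 the indicator of the diagonal. *)

theory Defs
  imports "HOL-Analysis.Analysis"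
begin

section \<open>Topological conventions\<close>

text \<open>The library's \<^const>\<open>compactin\<close> means quasi-compact. Spaces need not be Hausdorff unless this
  is required explicitly; compact means quasi-compact and Hausdorff.\<close>

definition compact_Hausdorff_in :: "'a topology \<Rightarrow> 'a set \<Rightarrow> bool" where
  "compact_Hausdorff_in T K \<longleftrightarrow> compactin T K \<and> Hausdorff_space (subtopology T K)"

definition loc_compact :: "'a topology \<Rightarrow> bool" where
  "loc_compact T \<longleftrightarrow>
     (\<forall>x\<in>topspace T. \<exists>U K. openin T U \<and> x \<in> U \<and> U \<subseteq> K \<and> compact_Hausdorff_in T K)"

text \<open>Not the library's \<^const>\<open>proper_map\<close> (closed with compact fibres), which may differ for
  non-Hausdorff spaces.\<close>

definition qc_proper :: "'a topology \<Rightarrow> 'b topology \<Rightarrow> ('a \<Rightarrow> 'b) \<Rightarrow> bool" where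
  "qc_proper S T f \<longleftrightarrow> f ` topspace S \<subseteq> topspace T \<and>
     (\<forall>K. compactin T K \<longrightarrow> compactin S {x \<in> topspace S. f x \<in> K})"

definition local_homeo :: "'a topology \<Rightarrow> 'b topology \<Rightarrow> ('a \<Rightarrow> 'b) \<Rightarrow> bool" where
  "local_homeo S T f \<longleftrightarrow> f ` topspace S \<subseteq> topspace T \<and>
     (\<forall>x\<in>topspace S. \<exists>U. openin S U \<and> x \<in> U \<and> openin T (f ` U) \<and>
        homeomorphic_map (subtopology S U) (subtopology T (f ` U)) f)"

definition paracompact :: "'a topology \<Rightarrow> bool" where
  "paracompact T \<longleftrightarrow>
     (\<forall>\<U>. (\<forall>U\<in>\<U>. openin T U) \<and> \<Union>\<U> = topspace T \<longrightarrow>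
        (\<exists>\<V>. (\<forall>V\<in>\<V>. openin T V \<and> (\<exists>U\<in>\<U>. V \<subseteq> U)) \<and> \<Union>\<V> = topspace T \<and>
             locally_finite_in T \<V>))"

definition quotient_topology :: "'a topology \<Rightarrow> ('a \<Rightarrow> 'b) \<Rightarrow> 'b topology" where
  "quotient_topology T q =
     topology (\<lambda>V. V \<subseteq> q ` topspace T \<and> openin T {x \<in> topspace T. q x \<in> V})"

lemma openin_quotient_topology:
  "openin (quotient_topology T q) V \<longleftrightarrow>
     V \<subseteq> q ` topspace T \<and> openin T {x \<in> topspace T. q x \<in> V}"
proof -
  have "istopology (\<lambda>V. V \<subseteq> q ` topspace T \<and> openin T {x \<in> topspace T. q x \<in> V})"
    unfolding istopology_def
  proof (intro conjI allI impI; (elim conjE)?)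
    fix A B
    assume "openin T {x \<in> topspace T. q x \<in> A}" "openin T {x \<in> topspace T. q x \<in> B}"
    then have "openin T ({x \<in> topspace T. q x \<in> A} \<inter> {x \<in> topspace T. q x \<in> B})"
      by (rule openin_Int)
    moreover have "{x \<in> topspace T. q x \<in> A} \<inter> {x \<in> topspace T. q x \<in> B} =
        {x \<in> topspace T. q x \<in> A \<inter> B}"
      by blast
    ultimately show "openin T {x \<in> topspace T. q x \<in> A \<inter> B}" by simp
  next
    fix \<K>
    assume *: "\<forall>K\<in>\<K>. K \<subseteq> q ` topspace T \<and> openin T {x \<in> topspace T. q x \<in> K}"
    then show "\<Union>\<K> \<subseteq> q ` topspace T" by blast
    have "openin T (\<Union>K\<in>\<K>. {x \<in> topspace T. q x \<in> K})"
      using * by blast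
    moreover have "(\<Union>K\<in>\<K>. {x \<in> topspace T. q x \<in> K}) = {x \<in> topspace T. q x \<in> \<Union>\<K>}"
      by blast
    ultimately show "openin T {x \<in> topspace T. q x \<in> \<Union>\<K>}" by simp
  qed blast
  then show ?thesis
    unfolding quotient_topology_def by (simp add: topology_inverse')
qed

definition fibre_product ::
    "'a topology \<Rightarrow> ('a \<Rightarrow> 'c) \<Rightarrow> 'b topology \<Rightarrow> ('b \<Rightarrow> 'c) \<Rightarrow> ('a \<times> 'b) topology" where
  "fibre_product S f T g = subtopology (prod_topology S T) {(a, b). f a = g b}"


section \<open>Compactly supported functions and measures\<close>

text \<open>Complex functions. Members of \<open>Cc P\<close> are total functions that vanish off the space.\<close>

definition Cc_basic :: "'a topology \<Rightarrow> ('a \<Rightarrow> complex) set" where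
  "Cc_basic P = {f. \<exists>V. openin P V \<and> Hausdorff_space (subtopology P V) \<and>
     continuous_map (subtopology P V) euclidean f \<and> (\<forall>p. p \<notin> V \<longrightarrow> f p = 0) \<and>
     compactin (subtopology P V) (subtopology P V closure_of {p \<in> V. f p \<noteq> 0})}"

definition Cc :: "'a topology \<Rightarrow> ('a \<Rightarrow> complex) set" where
  "Cc P = {f. \<exists>(n::nat) c g. (\<forall>i<n. g i \<in> Cc_basic P) \<and> f = (\<lambda>p. \<Sum>i<n. c i * g i p)}"

definition Cc_in :: "'a topology \<Rightarrow> 'a set \<Rightarrow> ('a \<Rightarrow> complex) set" where
  "Cc_in P U = {f \<in> Cc P. P closure_of {p \<in> topspace P. f p \<noteq> 0} \<subseteq> U}"

definition borel_of :: "'a topology \<Rightarrow> 'a measure" where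
  "borel_of T = sigma (topspace T) {U. openin T U}"

definition radon_measure :: "'a topology \<Rightarrow> 'a measure \<Rightarrow> bool" where
  "radon_measure T M \<longleftrightarrow> sets M = sets (borel_of T) \<and> sigma_finite_measure M \<and>
     (\<forall>K. compactin T K \<longrightarrow> emeasure M K < \<infinity>) \<and>
     (\<forall>A\<in>sets M. emeasure M A = (INF U\<in>{U. openin T U \<and> A \<subseteq> U}. emeasure M U)) \<and>
     (\<forall>U. openin T U \<longrightarrow>
        emeasure M U = (SUP K\<in>{K. compactin T K \<and> K \<in> sets M \<and> K \<subseteq> U}. emeasure M K))"

definition supp_measure :: "'a topology \<Rightarrow> 'a measure \<Rightarrow> 'a set" where
  "supp_measure T M = {x \<in> topspace T. \<forall>U. openin T U \<and> x \<in> U \<longrightarrow> emeasure M U \<noteq> 0}"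

text \<open>Atomic in the sense usual for Radon measures: a sum of point masses, i.e.
  \<open>M = (\<Sum>x. M {x} \<cdot> \<delta>\<^sub>x)\<close>. The integral over counting measure is this possibly infinite sum.\<close>

definition atomic_measure :: "'a measure \<Rightarrow> bool" where
  "atomic_measure M \<longleftrightarrow> (\<forall>x\<in>space M. {x} \<in> sets M) \<and>
     (\<forall>E\<in>sets M. emeasure M E = (\<integral>\<^sup>+ x. emeasure M {x} \<partial>count_space E))"


section \<open>Topological groupoids\<close>

text \<open>Units are identified with their identity arrows, so range and source are maps of arrows.
  Operations are only meaningful on \<open>arrows G\<close>, and the product only on composable pairs
  \<open>src \<gamma> = rng \<eta>\<close>.\<close>

record 'g groupoid =
  arr_top :: "'g topology"
  rng :: "'g \<Rightarrow> 'g"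
  src :: "'g \<Rightarrow> 'g"
  gmul :: "'g \<Rightarrow> 'g \<Rightarrow> 'g"
  ginv :: "'g \<Rightarrow> 'g"

definition arrows :: "'g groupoid \<Rightarrow> 'g set" where
  "arrows G = topspace (arr_top G)"

definition units :: "'g groupoid \<Rightarrow> 'g set" where
  "units G = rng G ` arrows G"

definition unit_top :: "'g groupoid \<Rightarrow> 'g topology" where
  "unit_top G = subtopology (arr_top G) (units G)"

definition rfibre :: "'g groupoid \<Rightarrow> 'g \<Rightarrow> 'g set" where
  "rfibre G u = {\<gamma> \<in> arrows G. rng G \<gamma> = u}"

locale topological_groupoid =
  fixes G :: "'g groupoid"
  assumes rng_arrow: "\<gamma> \<in> arrows G \<Longrightarrow> rng G \<gamma> \<in> arrows G"
    and src_unit: "\<gamma> \<in> arrows G \<Longrightarrow> src G \<gamma> \<in> units G"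
    and rng_of_unit: "u \<in> units G \<Longrightarrow> rng G u = u"
    and src_of_unit: "u \<in> units G \<Longrightarrow> src G u = u"
    and mul_arrow: "\<lbrakk>\<gamma> \<in> arrows G; \<eta> \<in> arrows G; src G \<gamma> = rng G \<eta>\<rbrakk> \<Longrightarrow> gmul G \<gamma> \<eta> \<in> arrows G"
    and rng_mul: "\<lbrakk>\<gamma> \<in> arrows G; \<eta> \<in> arrows G; src G \<gamma> = rng G \<eta>\<rbrakk>
                    \<Longrightarrow> rng G (gmul G \<gamma> \<eta>) = rng G \<gamma>"
    and src_mul: "\<lbrakk>\<gamma> \<in> arrows G; \<eta> \<in> arrows G; src G \<gamma> = rng G \<eta>\<rbrakk>
                    \<Longrightarrow> src G (gmul G \<gamma> \<eta>) = src G \<eta>"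
    and mul_assoc: "\<lbrakk>\<gamma> \<in> arrows G; \<eta> \<in> arrows G; \<zeta> \<in> arrows G; src G \<gamma> = rng G \<eta>; src G \<eta> = rng G \<zeta>\<rbrakk>
                    \<Longrightarrow> gmul G (gmul G \<gamma> \<eta>) \<zeta> = gmul G \<gamma> (gmul G \<eta> \<zeta>)"
    and unit_mul: "\<gamma> \<in> arrows G \<Longrightarrow> gmul G (rng G \<gamma>) \<gamma> = \<gamma>"
    and mul_unit: "\<gamma> \<in> arrows G \<Longrightarrow> gmul G \<gamma> (src G \<gamma>) = \<gamma>"
    and inv_arrow: "\<gamma> \<in> arrows G \<Longrightarrow> ginv G \<gamma> \<in> arrows G"
    and rng_inv: "\<gamma> \<in> arrows G \<Longrightarrow> rng G (ginv G \<gamma>) = src G \<gamma>"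
    and src_inv: "\<gamma> \<in> arrows G \<Longrightarrow> src G (ginv G \<gamma>) = rng G \<gamma>"
    and mul_inv: "\<gamma> \<in> arrows G \<Longrightarrow> gmul G \<gamma> (ginv G \<gamma>) = rng G \<gamma>"
    and inv_mul: "\<gamma> \<in> arrows G \<Longrightarrow> gmul G (ginv G \<gamma>) \<gamma> = src G \<gamma>"
    and continuous_rng: "continuous_map (arr_top G) (unit_top G) (rng G)"
    and continuous_src: "continuous_map (arr_top G) (unit_top G) (src G)"
    and continuous_inv: "continuous_map (arr_top G) (arr_top G) (ginv G)"
    and continuous_mul: "continuous_map (fibre_product (arr_top G) (src G) (arr_top G) (rng G))
                           (arr_top G) (\<lambda>(\<gamma>, \<eta>). gmul G \<gamma> \<eta>)"

locale etale_groupoid = topological_groupoid +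
  assumes rng_local_homeo: "local_homeo (arr_top G) (unit_top G) (rng G)"
    and units_loc_compact: "loc_compact (unit_top G)"
    and units_Hausdorff: "Hausdorff_space (unit_top G)"
    and countable_compact_basis:
      "\<exists>\<K>. countable \<K> \<and> (\<forall>K\<in>\<K>. compact_Hausdorff_in (arr_top G) K) \<and> \<Union>\<K> = arrows G \<and>
         (\<forall>W. openin (arr_top G) W \<longrightarrow>
            (\<exists>\<L>\<subseteq>\<K>. W = (\<Union>K\<in>\<L>. arr_top G interior_of K)))"

text \<open>The counting measure on \<open>rng\<inverse>(u)\<close>, as a Borel measure on the whole arrow space.\<close>

definition counting_haar :: "'g groupoid \<Rightarrow> 'g \<Rightarrow> 'g measure" where
  "counting_haar G u = distr (count_space (rfibre G u)) (borel_of (arr_top G)) (\<lambda>\<gamma>. \<gamma>)"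


section \<open>Bispaces\<close>

record ('g, 'h, 'x) bispace =
  sp_top :: "'x topology"
  lmom :: "'x \<Rightarrow> 'g"
  rmom :: "'x \<Rightarrow> 'h"
  lact :: "'g \<Rightarrow> 'x \<Rightarrow> 'x"
  ract :: "'x \<Rightarrow> 'h \<Rightarrow> 'x"

definition points :: "('g, 'h, 'x) bispace \<Rightarrow> 'x set" where
  "points X = topspace (sp_top X)"

definition sfibre :: "('g, 'h, 'x) bispace \<Rightarrow> 'h \<Rightarrow> 'x set" where
  "sfibre X z = {x \<in> points X. rmom X x = z}"

definition GX_top :: "'g groupoid \<Rightarrow> ('g, 'h, 'x) bispace \<Rightarrow> ('g \<times> 'x) topology" where
  "GX_top G X = fibre_product (arr_top G) (src G) (sp_top X) (lmom X)"

definition XH_top :: "'h groupoid \<Rightarrow> ('g, 'h, 'x) bispace \<Rightarrow> ('x \<times> 'h) topology" where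
  "XH_top H X = fibre_product (sp_top X) (rmom X) (arr_top H) (rng H)"

definition XX_top :: "('g, 'h, 'x) bispace \<Rightarrow> ('x \<times> 'x) topology" where
  "XX_top X = fibre_product (sp_top X) (rmom X) (sp_top X) (rmom X)"

definition left_space :: "'g groupoid \<Rightarrow> ('g, 'h, 'x) bispace \<Rightarrow> bool" where
  "left_space G X \<longleftrightarrow>
     continuous_map (sp_top X) (unit_top G) (lmom X) \<and>
     continuous_map (GX_top G X) (sp_top X) (\<lambda>(\<gamma>, x). lact X \<gamma> x) \<and>
     (\<forall>\<gamma>\<in>arrows G. \<forall>x\<in>points X. src G \<gamma> = lmom X x \<longrightarrow> lmom X (lact X \<gamma> x) = rng G \<gamma>) \<and>
     (\<forall>\<gamma>\<in>arrows G. \<forall>\<eta>\<in>arrows G. \<forall>x\<in>points X. src G \<gamma> = rng G \<eta> \<and> src G \<eta> = lmom X x \<longrightarrow>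
        lact X (gmul G \<gamma> \<eta>) x = lact X \<gamma> (lact X \<eta> x)) \<and>
     (\<forall>x\<in>points X. lact X (lmom X x) x = x)"

definition right_space :: "'h groupoid \<Rightarrow> ('g, 'h, 'x) bispace \<Rightarrow> bool" where
  "right_space H X \<longleftrightarrow>
     continuous_map (sp_top X) (unit_top H) (rmom X) \<and>
     continuous_map (XH_top H X) (sp_top X) (\<lambda>(x, \<eta>). ract X x \<eta>) \<and>
     (\<forall>x\<in>points X. \<forall>\<eta>\<in>arrows H. rmom X x = rng H \<eta> \<longrightarrow> rmom X (ract X x \<eta>) = src H \<eta>) \<and>
     (\<forall>x\<in>points X. \<forall>\<eta>\<in>arrows H. \<forall>\<zeta>\<in>arrows H. rmom X x = rng H \<eta> \<and> src H \<eta> = rng H \<zeta> \<longrightarrow>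
        ract X x (gmul H \<eta> \<zeta>) = ract X (ract X x \<eta>) \<zeta>) \<and>
     (\<forall>x\<in>points X. ract X x (rmom X x) = x)"

definition is_bispace :: "'g groupoid \<Rightarrow> 'h groupoid \<Rightarrow> ('g, 'h, 'x) bispace \<Rightarrow> bool" where
  "is_bispace G H X \<longleftrightarrow> left_space G X \<and> right_space H X \<and>
     (\<forall>\<gamma>\<in>arrows G. \<forall>x\<in>points X. src G \<gamma> = lmom X x \<longrightarrow> rmom X (lact X \<gamma> x) = rmom X x) \<and>
     (\<forall>x\<in>points X. \<forall>\<eta>\<in>arrows H. rmom X x = rng H \<eta> \<longrightarrow> lmom X (ract X x \<eta>) = lmom X x) \<and>
     (\<forall>\<gamma>\<in>arrows G. \<forall>x\<in>points X. \<forall>\<eta>\<in>arrows H. src G \<gamma> = lmom X x \<and> rmom X x = rng H \<eta> \<longrightarrow>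
        ract X (lact X \<gamma> x) \<eta> = lact X \<gamma> (ract X x \<eta>))"

definition proper_right_action :: "'h groupoid \<Rightarrow> ('g, 'h, 'x) bispace \<Rightarrow> bool" where
  "proper_right_action H X \<longleftrightarrow>
     qc_proper (XH_top H X) (prod_topology (sp_top X) (sp_top X)) (\<lambda>(x, \<eta>). (ract X x \<eta>, x))"

definition orbit :: "'h groupoid \<Rightarrow> ('g, 'h, 'x) bispace \<Rightarrow> 'x \<Rightarrow> 'x set" where
  "orbit H X x = {ract X x \<eta> | \<eta>. \<eta> \<in> arrows H \<and> rng H \<eta> = rmom X x}"

definition orbit_top :: "'h groupoid \<Rightarrow> ('g, 'h, 'x) bispace \<Rightarrow> 'x set topology" where
  "orbit_top H X = quotient_topology (sp_top X) (orbit H X)"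

text \<open>The map of \<open>X/H\<close> induced by the left momentum map, which is constant on orbits.\<close>

definition lmom_orbit :: "('g, 'h, 'x) bispace \<Rightarrow> 'x set \<Rightarrow> 'g" where
  "lmom_orbit X P = the_elem (lmom X ` P)"


section \<open>Topological correspondences\<close>

text \<open>Integrals over a fibre are written as set integrals: outside the fibre, which is a null set,
  the integrand may involve undefined products and need not be measurable.\<close>

definition continuous_family ::
    "'h groupoid \<Rightarrow> ('g, 'h, 'x) bispace \<Rightarrow> ('h \<Rightarrow> 'x measure) \<Rightarrow> bool" where
  "continuous_family H X lam \<longleftrightarrow>
     (\<forall>u\<in>units H. radon_measure (sp_top X) (lam u) \<and> emeasure (lam u) (points X - sfibre X u) = 0) \<and>
     (\<forall>f\<in>Cc (sp_top X). continuous_map (unit_top H) euclidean (\<lambda>u. LINT x|lam u. f x))"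

definition proper_family ::
    "'h groupoid \<Rightarrow> ('g, 'h, 'x) bispace \<Rightarrow> ('h \<Rightarrow> 'x measure) \<Rightarrow> bool" where
  "proper_family H X lam \<longleftrightarrow> (\<forall>u\<in>units H. emeasure (lam u) (points X) \<noteq> 0)"

definition invariant_family ::
    "'h groupoid \<Rightarrow> ('g, 'h, 'x) bispace \<Rightarrow> ('h \<Rightarrow> 'x measure) \<Rightarrow> bool" where
  "invariant_family H X lam \<longleftrightarrow>
     (\<forall>f\<in>Cc (sp_top X). \<forall>\<eta>\<in>arrows H.
        (LINT x:sfibre X (rng H \<eta>)|lam (rng H \<eta>). f (ract X x \<eta>)) = (LINT x|lam (src H \<eta>). f x))"

definition adjoining_function ::
    "'g groupoid \<Rightarrow> ('g \<Rightarrow> 'g measure) \<Rightarrow> 'h groupoid \<Rightarrow> ('g, 'h, 'x) bispace \<Rightarrow> ('h \<Rightarrow> 'x measure)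
      \<Rightarrow> ('g \<times> 'x \<Rightarrow> real) \<Rightarrow> bool" where
  "adjoining_function G \<alpha> H X lam \<Delta> \<longleftrightarrow>
     continuous_map (GX_top G X) (top_of_set {0<..}) \<Delta> \<and>
     (\<forall>u\<in>units H. \<forall>F\<in>Cc (GX_top G X).
        (LINT x|lam u. (LINT \<gamma>:rfibre G (lmom X x)|\<alpha> (lmom X x). F (ginv G \<gamma>, x))) =
        (LINT x|lam u. (LINT \<gamma>:rfibre G (lmom X x)|\<alpha> (lmom X x).
            F (\<gamma>, lact X (ginv G \<gamma>) x) * of_real (\<Delta> (\<gamma>, lact X (ginv G \<gamma>) x)))))"

text \<open>\<open>\<alpha>\<close> is the Haar system of \<open>G\<close>; the one of \<open>H\<close> does not enter the conditions and is
  therefore not a parameter.\<close>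

definition topological_correspondence ::
    "'g groupoid \<Rightarrow> ('g \<Rightarrow> 'g measure) \<Rightarrow> 'h groupoid \<Rightarrow> ('g, 'h, 'x) bispace \<Rightarrow> ('h \<Rightarrow> 'x measure)
      \<Rightarrow> bool" where
  "topological_correspondence G \<alpha> H X lam \<longleftrightarrow>
     loc_compact (sp_top X) \<and> is_bispace G H X \<and> proper_right_action H X \<and>
     continuous_family H X lam \<and> proper_family H X lam \<and> invariant_family H X lam \<and>
     (\<exists>\<Delta>. adjoining_function G \<alpha> H X lam \<Delta>)"


section \<open>Extensions via a map\<close>

definition open_onto_image :: "'a topology \<Rightarrow> 'b topology \<Rightarrow> ('a \<Rightarrow> 'b) \<Rightarrow> bool" where
  "open_onto_image P Q \<phi> \<longleftrightarrow> open_map P (subtopology Q (\<phi> ` topspace P)) \<phi>"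

definition HoCo :: "'a topology \<Rightarrow> 'b topology \<Rightarrow> ('a \<Rightarrow> 'b) \<Rightarrow> 'a set set" where
  "HoCo P Q \<phi> = {U. openin P U \<and> compact_Hausdorff_in P (P closure_of U) \<and>
     embedding_map (subtopology P U) Q \<phi> \<and> embedding_map (subtopology P (P closure_of U)) Q \<phi>}"

definition set_extension :: "'a topology \<Rightarrow> 'b topology \<Rightarrow> ('a \<Rightarrow> 'b) \<Rightarrow> 'a set \<Rightarrow> 'b set \<Rightarrow> bool" where
  "set_extension P Q \<phi> U U' \<longleftrightarrow> openin Q U' \<and> U' \<inter> \<phi> ` topspace P = \<phi> ` U"

definition fun_extension ::
    "'b topology \<Rightarrow> ('a \<Rightarrow> 'b) \<Rightarrow> 'a set \<Rightarrow> 'b set \<Rightarrow> ('a \<Rightarrow> complex) \<Rightarrow> ('b \<Rightarrow> complex) \<Rightarrow> bool" where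
  "fun_extension Q \<phi> U U' f f' \<longleftrightarrow> f' \<in> Cc_in Q U' \<and> (\<forall>p\<in>U. f' (\<phi> p) = f p)"

definition cover_extension ::
    "'a topology \<Rightarrow> 'b topology \<Rightarrow> ('a \<Rightarrow> 'b) \<Rightarrow> 'a set set \<Rightarrow> 'b set set \<Rightarrow> bool" where
  "cover_extension P Q \<phi> \<A> \<A>' \<longleftrightarrow>
     (\<forall>U'\<in>\<A>'. openin Q U' \<and>
        ((\<exists>U\<in>\<A>. set_extension P Q \<phi> U U') \<or> U' \<inter> \<phi> ` topspace P = {})) \<and>
     (\<forall>U\<in>\<A>. \<exists>U'\<in>\<A>'. set_extension P Q \<phi> U U')"


section \<open>Proper topological correspondences\<close>

definition m_map :: "('g, 'h, 'x) bispace \<Rightarrow> 'g \<times> 'x \<Rightarrow> 'x \<times> 'x" where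
  "m_map X = (\<lambda>(\<gamma>, x). (lact X \<gamma> x, x))"

definition loc_strongly_loc_free :: "'g groupoid \<Rightarrow> ('g, 'h, 'x) bispace \<Rightarrow> bool" where
  "loc_strongly_loc_free G X \<longleftrightarrow>
     (\<forall>\<gamma>\<in>arrows G. \<forall>y\<in>points X. lmom X y = src G \<gamma> \<longrightarrow>
        (\<exists>U V. openin (arr_top G) U \<and> \<gamma> \<in> U \<and> openin (sp_top X) V \<and> y \<in> V \<and>
           (\<forall>\<delta>\<in>U. \<forall>\<eta>\<in>U. \<forall>x\<in>V. src G \<delta> = lmom X x \<and> src G \<eta> = lmom X x \<and>
              lact X \<eta> x = lact X \<delta> x \<longrightarrow> \<eta> = \<delta>)))"

definition invariant_function ::
    "'h groupoid \<Rightarrow> ('g, 'h, 'x) bispace \<Rightarrow> ('x \<times> 'x \<Rightarrow> real) \<Rightarrow> bool" where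
  "invariant_function H X D \<longleftrightarrow>
     (\<forall>x\<in>points X. \<forall>y\<in>points X. \<forall>\<eta>\<in>arrows H. rmom X x = rmom X y \<and> rmom X x = rng H \<eta> \<longrightarrow>
        D (ract X x \<eta>, ract X y \<eta>) = D (x, y))"

definition condition_iii ::
    "'g groupoid \<Rightarrow> ('g \<Rightarrow> 'g measure) \<Rightarrow> ('g, 'h, 'x) bispace \<Rightarrow> ('h \<Rightarrow> 'x measure)
      \<Rightarrow> ('x \<times> 'x \<Rightarrow> real) \<Rightarrow> bool" where
  "condition_iii G \<alpha> X lam D \<longleftrightarrow>
     (\<exists>\<A> \<A>'. \<A> \<subseteq> HoCo (GX_top G X) (XX_top X) (m_map X) \<and> \<Union>\<A> = topspace (GX_top G X) \<and>
        cover_extension (GX_top G X) (XX_top X) (m_map X) \<A> \<A>' \<and>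
        (\<forall>U\<in>\<A>. \<forall>U'\<in>\<A>'. set_extension (GX_top G X) (XX_top X) (m_map X) U U' \<longrightarrow>
           (\<forall>f\<in>Cc_in (GX_top G X) U. \<forall>f'. fun_extension (XX_top X) (m_map X) U U' f f' \<longrightarrow>
              (\<forall>x\<in>points X.
                 (LINT y:sfibre X (rmom X x)|lam (rmom X x). f' (x, y) * of_real (D (x, y))) =
                 (LINT \<gamma>:rfibre G (lmom X x)|\<alpha> (lmom X x). f (\<gamma>, lact X (ginv G \<gamma>) x))))))"

text \<open>\<open>properness_function \<dots> D\<close>: conditions (i)--(iii), where (iii) holds with the function \<open>D\<close>.
  Condition (iii) involves \<open>f\<close> only through arrows of \<open>G \<ltimes> X\<close>, so it gives no positive lower bound
  for \<open>D\<close> off the image of \<^const>\<open>m_map\<close>: for trivial \<open>G\<close>, \<open>H\<close> and a two-point \<open>X\<close> the values of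
  \<open>D\<close> off the diagonal may be 0.\<close>

definition properness_function ::
    "'g groupoid \<Rightarrow> ('g \<Rightarrow> 'g measure) \<Rightarrow> 'h groupoid \<Rightarrow> ('g, 'h, 'x) bispace \<Rightarrow> ('h \<Rightarrow> 'x measure)
      \<Rightarrow> ('x \<times> 'x \<Rightarrow> real) \<Rightarrow> bool" where
  "properness_function G \<alpha> H X lam D \<longleftrightarrow>
     invariant_function H X D \<and> (\<forall>p\<in>topspace (XX_top X). 0 \<le> D p) \<and>
     continuous_map (XX_top X) euclideanreal D \<and>
     loc_strongly_loc_free G X \<and> open_onto_image (GX_top G X) (XX_top X) (m_map X) \<and>
     qc_proper (orbit_top H X) (unit_top G) (lmom_orbit X) \<and>
     condition_iii G \<alpha> X lam D"

definition proper_correspondence ::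
    "'g groupoid \<Rightarrow> ('g \<Rightarrow> 'g measure) \<Rightarrow> 'h groupoid \<Rightarrow> ('g, 'h, 'x) bispace \<Rightarrow> ('h \<Rightarrow> 'x measure)
      \<Rightarrow> bool" where
  "proper_correspondence G \<alpha> H X lam \<longleftrightarrow>
     topological_correspondence G \<alpha> H X lam \<and>
     Hausdorff_space (sp_top X) \<and> paracompact (orbit_top H X) \<and>
     (\<exists>D. properness_function G \<alpha> H X lam D)"

definition full_support ::
    "'h groupoid \<Rightarrow> ('g, 'h, 'x) bispace \<Rightarrow> ('h \<Rightarrow> 'x measure) \<Rightarrow> bool" where
  "full_support H X lam \<longleftrightarrow> (\<forall>z\<in>units H. supp_measure (sp_top X) (lam z) = sfibre X z)"

end

theory Submission
  imports Defs
begin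

text \<open>
  Fix an arrow \<open>\<gamma>\<close> of \<open>G\<close> and a point \<open>x\<close> with \<open>src \<gamma> = lmom x\<close>, and put \<open>w = \<gamma>x\<close>, \<open>z = rmom x\<close>.
  Test condition (iii) at the point \<open>w\<close> with a bump function \<open>\<phi>\<close> on \<open>X \<times> X\<close> (over the units of \<open>H\<close>)
  concentrated near \<open>(w, x)\<close> and equal to 1 there. The right-hand side is a sum over the range fibre
  of \<open>w\<close>, and this fibre is discrete because \<open>G\<close> is etale. If the support of \<open>\<phi>\<close> is small, only the
  arrow \<open>\<gamma>\<close> contributes, so that
  \<open>\<integral> \<phi>(w, y) D(w, y) d\<lambda>\<^sub>z(y) = 1\<close> for all such \<open>\<phi>\<close> (\<open>local_test_identity\<close> below).

  Shrinking the support of \<open>\<phi>\<close> to the point gives \<open>D(w, x) \<lambda>\<^sub>z{x} \<ge> 1\<close> by outer regularity. On the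
  other hand the single point \<open>x\<close> contributes \<open>D(w, x) \<lambda>\<^sub>z{x}\<close> to an integral of a nonnegative
  function whose value is 1. Hence \<open>D(w, x) \<lambda>\<^sub>z{x} = 1\<close>, which makes both factors positive, and nothing
  is left for the complement of \<open>x\<close>: as \<open>\<phi> D > 0\<close> near \<open>(w, x)\<close>, some neighbourhood of \<open>x\<close> carries
  no mass apart from the atom at \<open>x\<close> (\<open>point_mass\<close>). Taking \<open>\<gamma>\<close> to be a unit, this applies to
  every \<open>x\<close> in the fibre over \<open>z\<close>.

  A Radon measure with this isolation property is a sum of point masses
  (\<open>radon_isolated_atoms_imp_atomic\<close>): compact sets are finite up to null sets, and sigma-finiteness
  together with regularity reduces the whole space to a countable set.

  The arrow space of \<open>G\<close>, and hence that of \<open>G \<ltimes> X\<close>, may fail to be Hausdorff. The test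
  functions are therefore constructed on the Hausdorff side, on \<open>X \<times> X\<close>, and pulled back along
  \<open>m_map\<close> to a member of the cover, whose closure is compact Hausdorff and embedded by \<open>m_map\<close>.
\<close>


section \<open>Compactly supported functions\<close>

lemma loc_compact_imp_locally_compact_space:
  assumes "loc_compact T"
  shows "locally_compact_space T"
  using assms unfolding loc_compact_def compact_Hausdorff_in_def locally_compact_space_def by meson

lemma bump_function:
  fixes T :: "'a topology"
  assumes "locally_compact_space T" "Hausdorff_space T" "openin T N" "p \<in> N"
  obtains \<phi> :: "'a \<Rightarrow> real" and K
  where "continuous_map T euclideanreal \<phi>" "\<phi> p = 1" "\<And>q. 0 \<le> \<phi> q" "\<And>q. \<phi> q \<le> 1"
    "compactin T K" "K \<subseteq> N" "\<And>q. q \<notin> K \<Longrightarrow> \<phi> q = 0"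
proof -
  have "neighbourhood_base_of (\<lambda>C. compactin T C \<and> closedin T C) T"
    using assms(1,2) locally_compact_space_neighbourhood_base_closedin by blast
  then obtain W K where W: "openin T W" "compactin T K" "p \<in> W" "W \<subseteq> K" "K \<subseteq> N"
    using assms(3,4) unfolding neighbourhood_base_of by meson
  have "completely_regular_space T"
    using assms(1,2) locally_compact_regular_imp_completely_regular_space by blast
  moreover have "closedin T (topspace T - W)" "p \<in> topspace T - (topspace T - W)"
    using W openin_subset[of T W] by auto
  ultimately obtain f :: "'a \<Rightarrow> real" where f: "continuous_map T (top_of_set {0..1}) f" "f p = 0"
      "f ` (topspace T - W) \<subseteq> {1}"
    unfolding completely_regular_space_def by meson
  define \<phi> where "\<phi> = (\<lambda>q. if q \<in> topspace T then 1 - f q else 0)"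
  have range: "f q \<in> {0..1}" if "q \<in> topspace T" for q
    using f(1) that unfolding continuous_map_in_subtopology by auto
  have "continuous_map T euclideanreal (\<lambda>q. 1 - f q)"
    using f(1) unfolding continuous_map_in_subtopology by (intro continuous_intros) auto
  then have "continuous_map T euclideanreal \<phi>"
    by (rule continuous_map_eq) (simp add: \<phi>_def)
  moreover have "\<phi> p = 1"
    using f(2) W openin_subset[of T W] by (auto simp: \<phi>_def)
  moreover have "0 \<le> \<phi> q" "\<phi> q \<le> 1" for q
    using range[of q] by (auto simp: \<phi>_def)
  moreover have "\<phi> q = 0" if "q \<notin> K" for q
    using f(3) that W(4) by (force simp: \<phi>_def)
  ultimately show thesis
    using W(2,5) that by blast
qed

lemma Cc_inI:
  assumes V: "openin P V" "Hausdorff_space (subtopology P V)"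
    and f: "continuous_map (subtopology P V) euclidean f" "\<And>p. p \<notin> K \<Longrightarrow> f p = 0"
    and K: "compactin P K" "closedin P K" "K \<subseteq> V" "K \<subseteq> U"
  shows "f \<in> Cc_in P U"
proof -
  have KV: "compactin (subtopology P V) K"
    using K by (simp add: compactin_subtopology)
  then have "closedin (subtopology P V) K"
    by (rule compactin_imp_closedin[OF V(2)])
  then have sub: "subtopology P V closure_of {p \<in> V. f p \<noteq> 0} \<subseteq> K"
    by (intro closure_of_minimal) (use f(2) in auto)
  then have "compactin (subtopology P V) (subtopology P V closure_of {p \<in> V. f p \<noteq> 0})"
    by (intro closed_compactin[OF KV]) auto
  moreover have "\<forall>p. p \<notin> V \<longrightarrow> f p = 0"
    using f(2) K(3) by auto
  ultimately have "f \<in> Cc_basic P"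
    unfolding Cc_basic_def using V f(1) by blast
  then have "f \<in> Cc P"
    unfolding Cc_def by (intro CollectI exI[of _ "1::nat"] exI[of _ "\<lambda>_. 1"] exI[of _ "\<lambda>_. f"]) auto
  moreover have "P closure_of {p \<in> topspace P. f p \<noteq> 0} \<subseteq> K"
    by (intro closure_of_minimal K(2)) (use f(2) in auto)
  ultimately show ?thesis
    using K(4) unfolding Cc_in_def by auto
qed

text \<open>
  Members of \<^const>\<open>HoCo\<close> can be localised from the target: as \<open>m\<close> is injective on the closure
  of \<open>U\<close> and the image of the compact set \<open>P closure_of U - S\<close> is closed, the complement of that image
  is a neighbourhood of \<open>m p\<close> that only sees \<open>S\<close>. The case \<open>S = U\<close> already matters: the
  image of \<open>m\<close> need not be closed, and this keeps supports away from the image of the boundary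
  of \<open>U\<close>.
\<close>

lemma HoCo_separating_open:
  assumes Q: "Hausdorff_space Q" and U: "U \<in> HoCo P Q m"
    and S: "openin P S" "p \<in> S" "S \<subseteq> U"
  obtains N where "openin Q N" "m p \<in> N" "\<And>q. \<lbrakk>q \<in> P closure_of U; m q \<in> N\<rbrakk> \<Longrightarrow> q \<in> S"
proof -
  let ?C = "P closure_of U"
  have emb: "embedding_map (subtopology P ?C) Q m" and cpt: "compactin P ?C"
    using U unfolding HoCo_def compact_Hausdorff_in_def by auto
  have sub: "U \<subseteq> ?C" "?C \<subseteq> topspace P"
    using U by (auto simp: HoCo_def openin_subset closure_of_subset closure_of_subset_topspace)
  have ts: "topspace (subtopology P ?C) = ?C"
    using sub by auto
  have hm: "homeomorphic_map (subtopology P ?C) (subtopology Q (m ` ?C)) m"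
    using emb unfolding embedding_map_def ts .
  have cont: "continuous_map (subtopology P ?C) Q m"
    using homeomorphic_imp_continuous_map[OF hm] by (simp add: continuous_map_in_subtopology)
  have inj: "inj_on m ?C"
    using homeomorphic_imp_injective_map[OF hm] ts by simp
  have "closedin P (?C - S)"
    using S(1) by (simp add: closedin_diff)
  then have "compactin P (?C - S)"
    using closed_compactin[OF cpt] by blast
  then have "compactin (subtopology P ?C) (?C - S)"
    by (simp add: compactin_subtopology)
  then have "closedin Q (m ` (?C - S))"
    using image_compactin cont compactin_imp_closedin Q by blast
  then have "openin Q (topspace Q - m ` (?C - S))"
    by auto
  moreover have "p \<in> ?C"
    using S sub by auto
  then have "m p \<in> topspace Q"
    using cont ts by (metis continuous_map_image_subset_topspace image_subset_iff)
  moreover have "m p \<notin> m ` (?C - S)"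
    using inj \<open>p \<in> ?C\<close> S(2) by (auto dest: inj_onD)
  ultimately show thesis
    using that[of "topspace Q - m ` (?C - S)"] by blast
qed

text \<open>
  The last hypothesis keeps the support of the pullback off the boundary of \<open>U\<close>. That support is then
  closed in the compact set \<open>P closure_of U\<close>, and so it is closed in \<open>P\<close> even if \<open>P\<close> is not
  Hausdorff, where compactness alone would not suffice.
\<close>

lemma fun_extension_of_pullback:
  fixes h :: "'b \<Rightarrow> complex"
  assumes Q: "Hausdorff_space Q" and U: "U \<in> HoCo P Q m"
    and h: "continuous_map Q euclidean h" "\<And>q. q \<notin> K \<Longrightarrow> h q = 0"
    and K: "compactin Q K" "K \<subseteq> U'" "\<And>q. \<lbrakk>q \<in> P closure_of U; m q \<in> K\<rbrakk> \<Longrightarrow> q \<in> U"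
  defines "f \<equiv> \<lambda>p. if p \<in> U then h (m p) else 0"
  shows "f \<in> Cc_in P U" "fun_extension Q m U U' f h"
proof -
  let ?C = "P closure_of U"
  have opn: "openin P U" and cpt: "compactin P ?C" and Haus: "Hausdorff_space (subtopology P ?C)"
    and emb: "embedding_map (subtopology P ?C) Q m"
    using U unfolding HoCo_def compact_Hausdorff_in_def by auto
  have sub: "U \<subseteq> ?C" "?C \<subseteq> topspace P"
    using opn by (auto simp: openin_subset closure_of_subset closure_of_subset_topspace)
  have ts: "topspace (subtopology P ?C) = ?C"
    using sub by auto
  have cont: "continuous_map (subtopology P ?C) Q m"
    using emb homeomorphic_imp_continuous_map continuous_map_in_subtopology
    unfolding embedding_map_def by blast
  define L where "L = {p \<in> ?C. m p \<in> K}"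
  have LU: "L \<subseteq> U"
    using K(3) by (auto simp: L_def)
  have "closedin Q K"
    using compactin_imp_closedin Q K(1) by blast
  then have "closedin (subtopology P ?C) L"
    using closedin_continuous_map_preimage[OF cont] unfolding L_def ts by blast
  then have Lc: "closedin P L"
    using closedin_closed_subtopology[OF closedin_closure_of] by blast
  then have Lk: "compactin P L"
    using closed_compactin[OF cpt] by (auto simp: L_def)
  have HU: "Hausdorff_space (subtopology P U)"
    using Hausdorff_space_subtopology[OF Haus, of U] sub
    by (simp add: subtopology_subtopology Int_absorb1)
  have "continuous_map (subtopology P U) Q m"
    using cont sub(1) continuous_map_from_subtopology_mono by blast
  then have "continuous_map (subtopology P U) euclidean (h \<circ> m)"
    using h(1) continuous_map_compose by blast
  then have fc: "continuous_map (subtopology P U) euclidean f"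
    by (rule continuous_map_eq) (simp add: f_def)
  have "f p = 0" if "p \<notin> L" for p
    using that sub h(2) by (auto simp: f_def L_def)
  then show "f \<in> Cc_in P U"
    using Cc_inI[OF opn HU fc _ Lk Lc LU LU] by blast
  have "h \<in> Cc_in Q U'"
    using Cc_inI[of Q "topspace Q" h K U'] Q h K \<open>closedin Q K\<close> by (simp add: closedin_subset)
  then show "fun_extension Q m U U' f h"
    unfolding fun_extension_def by (simp add: f_def)
qed


section \<open>Integration against the counting Haar system\<close>

lemma space_borel_of [simp]: "space (borel_of T) = topspace T"
  unfolding borel_of_def by (rule space_measure_of) (auto dest: openin_subset)

lemma openin_imp_sets_borel_of: "openin T U \<Longrightarrow> U \<in> sets (borel_of T)"
  unfolding borel_of_def using openin_subset by (subst sets_measure_of) fastforce+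

lemma closedin_imp_sets_borel_of:
  assumes "closedin T C"
  shows "C \<in> sets (borel_of T)"
proof -
  have "space (borel_of T) - (topspace T - C) \<in> sets (borel_of T)"
    using assms openin_imp_sets_borel_of by blast
  moreover have "space (borel_of T) - (topspace T - C) = C"
    using closedin_subset[OF assms] by auto
  ultimately show ?thesis by simp
qed

context etale_groupoid
begin

lemma rng_injective_neighbourhood:
  assumes "\<gamma> \<in> arrows G"
  obtains B where "openin (arr_top G) B" "\<gamma> \<in> B" "inj_on (rng G) B"
proof -
  obtain B where B: "openin (arr_top G) B" "\<gamma> \<in> B"
      "homeomorphic_map (subtopology (arr_top G) B) (subtopology (unit_top G) (rng G ` B)) (rng G)"
    using rng_local_homeo assms unfolding local_homeo_def arrows_def by meson
  then have "inj_on (rng G) B"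
    by (metis homeomorphic_imp_injective_map openin_subset topspace_subtopology_subset)
  then show thesis
    using B that by blast
qed

text \<open>
  In a non-Hausdorff arrow space a point is still locally closed: a range fibre is closed, and
  an open set on which the range map is injective meets it in at most one point.
\<close>

lemma singleton_borel:
  assumes "\<gamma> \<in> arrows G"
  shows "{\<gamma>} \<in> sets (borel_of (arr_top G))"
proof -
  obtain B where B: "openin (arr_top G) B" "\<gamma> \<in> B" "inj_on (rng G) B"
    using rng_injective_neighbourhood[OF assms] .
  have "rng G \<gamma> \<in> topspace (unit_top G)"
    using continuous_rng assms unfolding arrows_def
    by (metis continuous_map_image_subset_topspace image_subset_iff)
  then have "closedin (unit_top G) {rng G \<gamma>}"
    by (simp add: units_Hausdorff closedin_Hausdorff_singleton)
  then have "closedin (arr_top G) {\<eta> \<in> topspace (arr_top G). rng G \<eta> \<in> {rng G \<gamma>}}"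
    using continuous_rng closedin_continuous_map_preimage by blast
  then have "B \<inter> {\<eta> \<in> topspace (arr_top G). rng G \<eta> \<in> {rng G \<gamma>}} \<in> sets (borel_of (arr_top G))"
    using B(1) openin_imp_sets_borel_of closedin_imp_sets_borel_of by blast
  moreover have "B \<inter> {\<eta> \<in> topspace (arr_top G). rng G \<eta> \<in> {rng G \<gamma>}} = {\<gamma>}"
    using B openin_subset by (auto dest: inj_onD)
  ultimately show ?thesis by simp
qed

lemma integral_counting_haar_single:
  fixes F :: "'a \<Rightarrow> complex"
  assumes \<gamma>: "\<gamma> \<in> rfibre G u" and F: "\<And>\<eta>. \<eta> \<in> rfibre G u \<Longrightarrow> \<eta> \<noteq> \<gamma> \<Longrightarrow> F \<eta> = 0"
  shows "(LINT \<eta>:rfibre G u|counting_haar G u. F \<eta>) = F \<gamma>"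
proof -
  let ?M = "counting_haar G u"
  have meas: "(\<lambda>\<gamma>. \<gamma>) \<in> measurable (count_space (rfibre G u)) (borel_of (arr_top G))"
    by (auto simp: rfibre_def arrows_def)
  have set: "{\<gamma>} \<in> sets (borel_of (arr_top G))"
    using singleton_borel \<gamma> by (auto simp: rfibre_def)
  have "emeasure ?M {\<gamma>} = emeasure (count_space (rfibre G u)) {\<gamma>}"
    unfolding counting_haar_def using emeasure_distr[OF meas set] \<gamma> by auto
  also have "\<dots> = 1"
    using \<gamma> by simp
  finally have one: "emeasure ?M {\<gamma>} = 1" .
  then have "measure ?M {\<gamma>} = 1"
    by (simp add: measure_def)
  have "(LINT \<eta>:rfibre G u|?M. F \<eta>) = (LINT \<eta>|?M. indicator {\<gamma>} \<eta> *\<^sub>R F \<gamma>)"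
    unfolding set_lebesgue_integral_def
    by (intro Bochner_Integration.integral_cong refl) (use \<gamma> F in \<open>auto split: split_indicator\<close>)
  also have "\<dots> = measure ?M {\<gamma>} *\<^sub>R F \<gamma>"
    using set one by (intro has_bochner_integral_integral_eq has_bochner_integral_indicator) (auto simp: counting_haar_def)
  finally show ?thesis
    using \<open>measure ?M {\<gamma>} = 1\<close> by simp
qed

end


section \<open>Radon measures with isolated atoms\<close>

lemma compact_almost_finite:
  assumes sets: "sets M = sets (borel_of T)" and "Hausdorff_space T"
    and loc: "\<And>x. x \<in> topspace T \<Longrightarrow> \<exists>V. openin T V \<and> x \<in> V \<and> emeasure M (V - {x}) = 0"
    and K: "compactin T K"
  obtains F where "finite F" "F \<subseteq> topspace T" "emeasure M (K - F) = 0"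
proof -
  have open_sets: "openin T U \<Longrightarrow> U \<in> sets M" for U
    by (simp add: sets openin_imp_sets_borel_of)
  have single: "{x} \<in> sets M" if "x \<in> topspace T" for x
    by (simp add: sets closedin_imp_sets_borel_of closedin_Hausdorff_singleton that assms(2))
  obtain V where V: "\<And>x. x \<in> topspace T \<Longrightarrow> openin T (V x)" "\<And>x. x \<in> topspace T \<Longrightarrow> x \<in> V x"
      "\<And>x. x \<in> topspace T \<Longrightarrow> emeasure M (V x - {x}) = 0"
    using loc by metis
  have "K \<subseteq> \<Union>(V ` topspace T)"
    using compactin_subset_topspace[OF K] V(2) by blast
  then have "\<exists>\<F>. finite \<F> \<and> \<F> \<subseteq> V ` topspace T \<and> K \<subseteq> \<Union>\<F>"
    by (intro compactinD[OF K]) (use V(1) in blast)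
  then obtain F where F: "finite F" "F \<subseteq> topspace T" "K \<subseteq> (\<Union>x\<in>F. V x)"
    by (metis finite_subset_image)
  have "(\<Union>x\<in>F. V x - {x}) \<in> null_sets M"
    by (intro null_sets.finite_UN F null_setsI) (use F V open_sets single in \<open>auto intro!: sets.Diff\<close>)
  moreover have "K - F \<in> sets M"
  proof -
    have "F \<in> sets M"
      using F(1,2) single by (induction F rule: finite_induct) (auto intro: sets.insert_in_sets)
    moreover have "K \<in> sets M"
      by (simp add: K assms(2) sets closedin_imp_sets_borel_of compactin_imp_closedin)
    ultimately show ?thesis by blast
  qed
  moreover have "K - F \<subseteq> (\<Union>x\<in>F. V x - {x})"
    using F(3) by auto
  ultimately have "K - F \<in> null_sets M"
    using null_sets_subset by blast
  then show thesis
    using F that by blast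
qed

text \<open>
  The point is to find a countable set \<open>Z\<close> of full measure: by inner regularity each open set of
  finite measure is, up to a null set, a countable union of compact sets, each of which is finite
  up to a null set; outer regularity covers the pieces of a sigma-finite decomposition by such
  open sets.
\<close>

lemma radon_isolated_atoms_imp_atomic:
  fixes T :: "'a topology"
  assumes radon: "radon_measure T M" and Haus: "Hausdorff_space T"
    and loc: "\<And>x. x \<in> topspace T \<Longrightarrow> \<exists>V. openin T V \<and> x \<in> V \<and> emeasure M (V - {x}) = 0"
  shows "atomic_measure M"
proof -
  have sets: "sets M = sets (borel_of T)" and sf: "sigma_finite_measure M"
    and outer: "\<And>A. A \<in> sets M \<Longrightarrow> emeasure M A = (INF U\<in>{U. openin T U \<and> A \<subseteq> U}. emeasure M U)"
    and inner: "\<And>U. openin T U \<Longrightarrow>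
        emeasure M U = (SUP K\<in>{K. compactin T K \<and> K \<in> sets M \<and> K \<subseteq> U}. emeasure M K)"
    using radon unfolding radon_measure_def by blast+
  have sp: "space M = topspace T"
    using sets_eq_imp_space_eq[OF sets] by simp
  have open_sets: "openin T U \<Longrightarrow> U \<in> sets M" for U
    by (simp add: sets openin_imp_sets_borel_of)
  have single: "{x} \<in> sets M" if "x \<in> topspace T" for x
    by (simp add: sets closedin_imp_sets_borel_of closedin_Hausdorff_singleton that Haus)
  have csets: "C \<in> sets M" if "countable C" "C \<subseteq> topspace T" for C
    using that single sets.countable[of C M] by auto
  have open_conc: "\<exists>C. countable C \<and> C \<subseteq> topspace T \<and> emeasure M (U - C) = 0"
    if U: "openin T U" "emeasure M U \<noteq> \<infinity>" for U
  proof -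
    let ?\<K> = "{K. compactin T K \<and> K \<in> sets M \<and> K \<subseteq> U}"
    have "?\<K> \<noteq> {}" by auto
    from ennreal_SUP_countable_SUP[OF this, of "emeasure M"]
    obtain e :: "nat \<Rightarrow> ennreal" where e: "range e \<subseteq> emeasure M ` ?\<K>"
        "(SUP K\<in>?\<K>. emeasure M K) = (SUP n. e n)"
      by auto
    then have "\<forall>n. \<exists>K. K \<in> ?\<K> \<and> e n = emeasure M K" by blast
    then obtain K where K: "\<And>n. K n \<in> ?\<K>" "\<And>n. e n = emeasure M (K n)" by metis
    have "\<forall>n. \<exists>F. finite F \<and> F \<subseteq> topspace T \<and> emeasure M (K n - F) = 0"
      using compact_almost_finite[OF sets Haus loc] K(1) by (metis (no_types, lifting) mem_Collect_eq)
    then obtain F where F: "\<And>n. finite (F n)" "\<And>n. F n \<subseteq> topspace T" "\<And>n. emeasure M (K n - F n) = 0"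
      by metis
    let ?D = "\<Union>n. K n" and ?C = "\<Union>n. F n"
    have D: "?D \<in> sets M" "?D \<subseteq> U"
      using K(1) by auto
    have C: "countable ?C"
      using countable_UN[of UNIV F] countable_finite[OF F(1)] by simp
    have C_sub: "?C \<subseteq> topspace T"
      using F(2) by blast
    have "emeasure M U = (SUP n. e n)"
      using inner[OF U(1)] e(2) by simp
    also have "\<dots> \<le> emeasure M ?D"
      by (intro SUP_least) (use K D in \<open>auto intro!: emeasure_mono\<close>)
    finally have "emeasure M ?D = emeasure M U"
      using emeasure_mono[OF D(2) open_sets[OF U(1)]] by simp
    then have "emeasure M (U - ?D) = 0"
      using emeasure_Diff[of M ?D U] D U open_sets by simp
    then have "U - ?D \<in> null_sets M"
      using D U open_sets by auto
    moreover have "(\<Union>n. K n - F n) \<in> null_sets M"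
    proof (intro null_sets_UN null_setsI F(3))
      show "K n - F n \<in> sets M" for n
        using K(1)[of n] csets[OF countable_finite[OF F(1)] F(2)] by blast
    qed
    ultimately have "(U - ?D) \<union> (\<Union>n. K n - F n) \<in> null_sets M"
      by (rule null_sets.Un)
    moreover have "U - ?C \<subseteq> (U - ?D) \<union> (\<Union>n. K n - F n)"
      by auto
    moreover have "U - ?C \<in> sets M"
      using U open_sets csets[OF C C_sub] by blast
    ultimately have "U - ?C \<in> null_sets M"
      using null_sets_subset by blast
    then show ?thesis
      using C C_sub by blast
  qed
  obtain A :: "nat \<Rightarrow> 'a set" where A: "range A \<subseteq> sets M" "(\<Union>i. A i) = space M"
      "\<And>i. emeasure M (A i) \<noteq> \<infinity>"
    by (rule sigma_finite_measure.sigma_finite[OF sf]) (rule that)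
  have "\<exists>C. countable C \<and> C \<subseteq> topspace T \<and> A i - C \<in> null_sets M" for i
  proof -
    have Ai: "A i \<in> sets M"
      using A(1) by auto
    have "(INF U\<in>{U. openin T U \<and> A i \<subseteq> U}. emeasure M U) < \<infinity>"
      unfolding outer[OF Ai, symmetric] using A(3)[of i] by (simp add: less_top)
    then obtain U where U: "openin T U" "A i \<subseteq> U" "emeasure M U < \<infinity>"
      unfolding INF_less_iff by auto
    then obtain C where C: "countable C" "C \<subseteq> topspace T" "emeasure M (U - C) = 0"
      using open_conc[OF U(1)] by (auto simp: less_top)
    then have "U - C \<in> null_sets M"
      using open_sets[OF U(1)] csets by blast
    then have "A i - C \<in> null_sets M"
      using null_sets_subset[of "U - C" M "A i - C"] U(2) Ai csets[OF C(1,2)] by blast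
    then show ?thesis
      using C by blast
  qed
  then obtain C where C: "\<And>i. countable (C i)" "\<And>i. C i \<subseteq> topspace T" "\<And>i. A i - C i \<in> null_sets M"
    by metis
  define Z where "Z = (\<Union>i. C i)"
  have Z: "countable Z" "Z \<subseteq> topspace T"
    using C by (auto simp: Z_def)
  have "(\<Union>i. A i - C i) \<in> null_sets M"
    using C(3) by blast
  moreover have "space M - Z \<subseteq> (\<Union>i. A i - C i)"
    using A(2) by (auto simp: Z_def)
  ultimately have null: "space M - Z \<in> null_sets M"
    using null_sets_subset csets[OF Z] by blast
  have "emeasure M E = (\<integral>\<^sup>+ x. emeasure M {x} \<partial>count_space E)" if E: "E \<in> sets M" for E
  proof -
    have Esub: "E \<subseteq> topspace T"
      using sets.sets_into_space[OF E] sp by simp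
    have off: "emeasure M {x} = 0" if "x \<in> E - Z" for x
      using null_sets_subset[OF null, of "{x}"] single that Esub sp by auto
    have "E - Z \<in> null_sets M"
      using null_sets_subset[OF null, of "E - Z"] E csets[OF Z] Esub sp by auto
    then have "emeasure M E = emeasure M (E - (E - Z))"
      using emeasure_Diff_null_set[OF _ E] by simp
    also have "E - (E - Z) = E \<inter> Z"
      by auto
    also have "emeasure M (E \<inter> Z) = (\<integral>\<^sup>+ x. emeasure M {x} \<partial>count_space (E \<inter> Z))"
      by (rule emeasure_countable_singleton) (use Z single in auto)
    also have "\<dots> = (\<integral>\<^sup>+ x. emeasure M {x} \<partial>count_space E)"
      by (rule nn_integral_count_space_eq) (use off in auto)
    finally show ?thesis .
  qed
  then show ?thesis
    unfolding atomic_measure_def using single sp by auto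
qed


section \<open>Point masses of a correspondence of etale groupoids\<close>

locale etale_correspondence = G: etale_groupoid G + H: etale_groupoid H
  for G :: "'g groupoid" and H :: "'h groupoid" +
  fixes X :: "('g, 'h, 'x) bispace" and lam :: "'h \<Rightarrow> 'x measure"
  assumes correspondence: "topological_correspondence G (counting_haar G) H X lam"
    and Hausdorff: "Hausdorff_space (sp_top X)"
begin

lemma topspace_GX: "topspace (GX_top G X) = {(\<gamma>, x). \<gamma> \<in> arrows G \<and> x \<in> points X \<and> src G \<gamma> = lmom X x}"
  by (auto simp: GX_top_def fibre_product_def arrows_def points_def)

lemma topspace_XX: "topspace (XX_top X) = {(x, y). x \<in> points X \<and> y \<in> points X \<and> rmom X x = rmom X y}"
  by (auto simp: XX_top_def fibre_product_def points_def)

lemma continuous_lmom: "continuous_map (sp_top X) (unit_top G) (lmom X)"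
  and continuous_rmom: "continuous_map (sp_top X) (unit_top H) (rmom X)"
  using correspondence
  unfolding topological_correspondence_def is_bispace_def left_space_def right_space_def by blast+

lemma lmom_unit: "x \<in> points X \<Longrightarrow> lmom X x \<in> units G"
  using continuous_map_image_subset_topspace[OF continuous_lmom]
  by (auto simp: unit_top_def points_def)

lemma rmom_unit: "x \<in> points X \<Longrightarrow> rmom X x \<in> units H"
  using continuous_map_image_subset_topspace[OF continuous_rmom]
  by (auto simp: unit_top_def points_def)

lemma unit_arrow: "u \<in> units G \<Longrightarrow> u \<in> arrows G"
  unfolding units_def using G.rng_arrow by auto

lemma closedin_sfibre:
  assumes "z \<in> units H"
  shows "closedin (sp_top X) (sfibre X z)"
proof -
  have "z \<in> topspace (unit_top H)"
    using assms H.rng_arrow by (auto simp: unit_top_def units_def arrows_def)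
  then have "closedin (unit_top H) {z}"
    by (simp add: H.units_Hausdorff closedin_Hausdorff_singleton)
  then have "closedin (sp_top X) {x \<in> topspace (sp_top X). rmom X x \<in> {z}}"
    using continuous_rmom closedin_continuous_map_preimage by blast
  then show ?thesis
    by (simp add: sfibre_def points_def)
qed

lemma Hausdorff_XX: "Hausdorff_space (XX_top X)"
  unfolding XX_top_def fibre_product_def
  by (intro Hausdorff_space_subtopology) (simp add: Hausdorff_space_prod_topology Hausdorff)

lemma locally_compact_XX: "locally_compact_space (XX_top X)"
proof -
  let ?P = "prod_topology (sp_top X) (sp_top X)"
  have "locally_compact_space (sp_top X)"
    using correspondence loc_compact_imp_locally_compact_space
    unfolding topological_correspondence_def by blast
  then have "locally_compact_space ?P"
    by (simp add: locally_compact_space_prod_topology)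
  moreover have "closedin ?P {p \<in> topspace ?P. (rmom X \<circ> fst) p = (rmom X \<circ> snd) p}"
    using continuous_map_compose[OF continuous_map_fst continuous_rmom]
      continuous_map_compose[OF continuous_map_snd continuous_rmom]
    by (intro closedin_continuous_maps_eq[OF H.units_Hausdorff])
  ultimately have "locally_compact_space
      (subtopology ?P {p \<in> topspace ?P. (rmom X \<circ> fst) p = (rmom X \<circ> snd) p})"
    by (rule locally_compact_space_closed_subset)
  moreover have "{p \<in> topspace ?P. (rmom X \<circ> fst) p = (rmom X \<circ> snd) p} =
      topspace ?P \<inter> {(a, b). rmom X a = rmom X b}"
    by auto
  ultimately show ?thesis
    by (simp only: subtopology_restrict XX_top_def fibre_product_def)
qed

lemma radon: "z \<in> units H \<Longrightarrow> radon_measure (sp_top X) (lam z)"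
  and off_fibre_null: "z \<in> units H \<Longrightarrow> emeasure (lam z) (points X - sfibre X z) = 0"
  using correspondence unfolding topological_correspondence_def continuous_family_def by blast+

lemma sets_lam: "z \<in> units H \<Longrightarrow> sets (lam z) = sets (borel_of (sp_top X))"
  using radon unfolding radon_measure_def by blast

lemma space_lam: "z \<in> units H \<Longrightarrow> space (lam z) = points X"
  using sets_eq_imp_space_eq[OF sets_lam] by (simp add: points_def)

lemma translate:
  assumes "\<gamma> \<in> arrows G" "x \<in> points X" "src G \<gamma> = lmom X x"
  shows "lact X \<gamma> x \<in> points X" "lmom X (lact X \<gamma> x) = rng G \<gamma>"
    "rmom X (lact X \<gamma> x) = rmom X x" "lact X (ginv G \<gamma>) (lact X \<gamma> x) = x"
proof -
  have left: "left_space G X" and bi: "is_bispace G H X"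
    using correspondence unfolding topological_correspondence_def is_bispace_def by blast+
  have "continuous_map (GX_top G X) (sp_top X) (\<lambda>(\<gamma>, x). lact X \<gamma> x)"
    using left unfolding left_space_def by blast
  from continuous_map_image_subset_topspace[OF this]
  show "lact X \<gamma> x \<in> points X"
    using assms unfolding topspace_GX points_def by force
  show "lmom X (lact X \<gamma> x) = rng G \<gamma>"
    using assms left unfolding left_space_def by blast
  show "rmom X (lact X \<gamma> x) = rmom X x"
    using assms bi unfolding is_bispace_def by blast
  have "lact X (gmul G (ginv G \<gamma>) \<gamma>) x = lact X (ginv G \<gamma>) (lact X \<gamma> x)"
    using left assms G.inv_arrow G.src_inv unfolding left_space_def by blast
  moreover have "gmul G (ginv G \<gamma>) \<gamma> = lmom X x"
    using assms G.inv_mul by simp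
  moreover have "lact X (lmom X x) x = x"
    using left assms(2) unfolding left_space_def by blast
  ultimately show "lact X (ginv G \<gamma>) (lact X \<gamma> x) = x"
    by simp
qed

text \<open>
  The set \<open>S\<close> in the proof consists of those arrows of a cover member \<open>U\<close> whose \<open>G\<close>-component lies
  in a neighbourhood \<open>B\<close> of \<open>\<gamma>\<close> on which the range map is injective. Localising to \<open>S\<close> leaves \<open>\<gamma>\<close>
  as the only arrow with range \<open>lmom (\<gamma>x)\<close> in the sum on the right-hand side of (iii).
\<close>

lemma local_test_identity:
  assumes iii: "condition_iii G (counting_haar G) X lam D"
    and \<gamma>x: "\<gamma> \<in> arrows G" "x \<in> points X" "src G \<gamma> = lmom X x"
  obtains N where "openin (XX_top X) N" "(lact X \<gamma> x, x) \<in> N"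
    "\<And>\<phi> K. \<lbrakk>continuous_map (XX_top X) euclideanreal \<phi>; \<phi> (lact X \<gamma> x, x) = 1;
        compactin (XX_top X) K; K \<subseteq> N; \<And>q. q \<notin> K \<Longrightarrow> \<phi> q = 0\<rbrakk>
      \<Longrightarrow> (LINT y:sfibre X (rmom X x)|lam (rmom X x).
             \<phi> (lact X \<gamma> x, y) * D (lact X \<gamma> x, y)) = 1"
proof -
  let ?P = "GX_top G X" and ?Q = "XX_top X" and ?m = "m_map X"
  define w where "w = lact X \<gamma> x"
  note w = translate[OF \<gamma>x, folded w_def]
  obtain \<A> \<A>' where A: "\<A> \<subseteq> HoCo ?P ?Q ?m" "\<Union>\<A> = topspace ?P" "cover_extension ?P ?Q ?m \<A> \<A>'"
    and test: "\<forall>U\<in>\<A>. \<forall>U'\<in>\<A>'. set_extension ?P ?Q ?m U U' \<longrightarrow>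
        (\<forall>f\<in>Cc_in ?P U. \<forall>f'. fun_extension ?Q ?m U U' f f' \<longrightarrow>
          (\<forall>x\<in>points X.
            (LINT y:sfibre X (rmom X x)|lam (rmom X x). f' (x, y) * of_real (D (x, y))) =
            (LINT \<gamma>:rfibre G (lmom X x)|counting_haar G (lmom X x). f (\<gamma>, lact X (ginv G \<gamma>) x))))"
    using iii unfolding condition_iii_def by - (elim exE conjE, rule that)
  have p: "(\<gamma>, x) \<in> topspace ?P"
    using \<gamma>x by (simp add: topspace_GX)
  then obtain U where U: "U \<in> \<A>" "(\<gamma>, x) \<in> U"
    using A(2) by blast
  then obtain U' where U': "U' \<in> \<A>'" "set_extension ?P ?Q ?m U U'"
    using A(3) unfolding cover_extension_def by blast
  have UH: "U \<in> HoCo ?P ?Q ?m"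
    using U A by blast
  then have opU: "openin ?P U"
    by (simp add: HoCo_def)
  have mp: "?m (\<gamma>, x) = (w, x)"
    by (simp add: m_map_def w_def)
  obtain B where B: "openin (arr_top G) B" "\<gamma> \<in> B" "inj_on (rng G) B"
    using G.rng_injective_neighbourhood[OF \<gamma>x(1)] .
  define S where "S = U \<inter> {q \<in> topspace ?P. fst q \<in> B}"
  have "continuous_map ?P (arr_top G) fst"
    unfolding GX_top_def fibre_product_def
    by (rule continuous_map_from_subtopology[OF continuous_map_fst])
  then have "openin ?P S"
    unfolding S_def by (rule openin_Int[OF opU openin_continuous_map_preimage[OF _ B(1)]])
  moreover have "(\<gamma>, x) \<in> S" "S \<subseteq> U"
    using B U p unfolding S_def by auto
  ultimately have S: "openin ?P S" "(\<gamma>, x) \<in> S" "S \<subseteq> U" .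
  obtain N0 where N0: "openin ?Q N0" "?m (\<gamma>, x) \<in> N0"
      "\<And>q. \<lbrakk>q \<in> ?P closure_of U; ?m q \<in> N0\<rbrakk> \<Longrightarrow> q \<in> S"
    using HoCo_separating_open[OF Hausdorff_XX UH S] by metis
  define N where "N = U' \<inter> N0"
  have "openin ?Q N"
    using N0(1) U'(2) unfolding N_def set_extension_def by blast
  moreover have "?m (\<gamma>, x) \<in> U'"
    using U'(2) U(2) unfolding set_extension_def by blast
  then have "(w, x) \<in> N"
    using N0(2) by (simp add: mp N_def)
  moreover have "(LINT y:sfibre X (rmom X x)|lam (rmom X x). \<phi> (w, y) * D (w, y)) = 1"
    if \<phi>: "continuous_map ?Q euclideanreal \<phi>" "\<phi> (w, x) = 1" "\<And>q. q \<notin> K \<Longrightarrow> \<phi> q = 0"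
      and K: "compactin ?Q K" "K \<subseteq> N" for \<phi> K
  proof -
    define h where "h = (\<lambda>q. complex_of_real (\<phi> q))"
    define f where "f = (\<lambda>q. if q \<in> U then h (?m q) else 0)"
    have "continuous_map ?Q euclidean h"
      unfolding h_def by (rule continuous_map_compose[OF \<phi>(1), unfolded o_def])
        (simp add: continuous_on_of_real)
    moreover have "K \<subseteq> U'"
      using K(2) unfolding N_def by blast
    moreover have "\<And>q. \<lbrakk>q \<in> ?P closure_of U; ?m q \<in> K\<rbrakk> \<Longrightarrow> q \<in> U"
      using K(2) N0(3) S(3) unfolding N_def by blast
    ultimately have f: "f \<in> Cc_in ?P U" "fun_extension ?Q ?m U U' f h"
      using fun_extension_of_pullback[OF Hausdorff_XX UH, of h K U'] K(1) \<phi>(3)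
      unfolding f_def h_def by auto
    have \<gamma>fib: "\<gamma> \<in> rfibre G (lmom X w)"
      using \<gamma>x w by (simp add: rfibre_def)
    have single: "f (\<eta>, lact X (ginv G \<eta>) w) = 0" if \<eta>: "\<eta> \<in> rfibre G (lmom X w)" "\<eta> \<noteq> \<gamma>" for \<eta>
    proof (rule ccontr)
      let ?q = "(\<eta>, lact X (ginv G \<eta>) w)"
      assume "f ?q \<noteq> 0"
      then have "?q \<in> U" "\<phi> (?m ?q) \<noteq> 0"
        by (auto simp: f_def h_def split: if_splits)
      moreover from this have "?m ?q \<in> K"
        using \<phi>(3)[of "?m ?q"] by blast
      moreover have "?q \<in> ?P closure_of U"
        using \<open>?q \<in> U\<close> closure_of_subset[OF openin_subset[OF opU]] by blast
      ultimately have "?q \<in> S"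
        using N0(3) K(2) unfolding N_def by blast
      then have "\<eta> \<in> B"
        by (simp add: S_def)
      moreover have "rng G \<eta> = rng G \<gamma>"
        using \<eta>(1) w by (simp add: rfibre_def)
      ultimately show False
        using B \<eta>(2) by (auto dest: inj_onD)
    qed
    have "(LINT y:sfibre X (rmom X x)|lam (rmom X x). complex_of_real (\<phi> (w, y) * D (w, y))) =
        (LINT y:sfibre X (rmom X w)|lam (rmom X w). h (w, y) * of_real (D (w, y)))"
      using w by (simp add: h_def)
    also have "\<dots> = (LINT \<eta>:rfibre G (lmom X w)|counting_haar G (lmom X w). f (\<eta>, lact X (ginv G \<eta>) w))"
      by (rule test[rule_format, OF U(1) U' f w(1)])
    also have "\<dots> = f (\<gamma>, lact X (ginv G \<gamma>) w)"
      using G.integral_counting_haar_single[OF \<gamma>fib, of "\<lambda>\<eta>. f (\<eta>, lact X (ginv G \<eta>) w)"] single by blast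
    also have "\<dots> = 1"
      using w U(2) \<phi>(2) mp by (simp add: f_def h_def)
    finally show ?thesis
      by (simp only: set_integral_complex_of_real of_real_eq_1_iff)
  qed
  ultimately show thesis
    using that[of N] unfolding w_def by blast
qed

text \<open>
  The first claim combines an upper and a lower bound for the contribution of \<open>x\<close> to
  the integral in the preceding lemma. Equality in the lower bound forces the integrand to vanish
  almost everywhere off \<open>x\<close>; since it is positive on the fibre near \<open>x\<close>, no other mass is left there.
\<close>

lemma point_mass:
  assumes iii: "condition_iii G (counting_haar G) X lam D"
    and nonneg: "\<And>p. p \<in> topspace (XX_top X) \<Longrightarrow> 0 \<le> D p"
    and cont: "continuous_map (XX_top X) euclideanreal D"
    and \<gamma>x: "\<gamma> \<in> arrows G" "x \<in> points X" "src G \<gamma> = lmom X x"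
  shows "D (lact X \<gamma> x, x) * measure (lam (rmom X x)) {x} = 1"
    and "\<exists>V. openin (sp_top X) V \<and> x \<in> V \<and> emeasure (lam (rmom X x)) (V - {x}) = 0"
proof -
  let ?Q = "XX_top X"
  define w z M d where "w = lact X \<gamma> x" and "z = rmom X x" and "M = lam z" and "d = D (w, x)"
  note w = translate[OF \<gamma>x, folded w_def z_def]
  have z: "z \<in> units H"
    using rmom_unit \<gamma>x by (simp add: z_def)
  have fib: "y \<in> sfibre X z \<longleftrightarrow> (w, y) \<in> topspace ?Q" for y
    using w by (auto simp: sfibre_def topspace_XX)
  have xfib: "x \<in> sfibre X z"
    using \<gamma>x by (simp add: sfibre_def z_def)
  have sets: "sets M = sets (borel_of (sp_top X))" and space: "space M = points X"
    using sets_lam space_lam z by (auto simp: M_def)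
  have open_sets: "V \<in> sets M" if "openin (sp_top X) V" for V
    using that by (simp add: sets openin_imp_sets_borel_of)
  have x_sets: "{x} \<in> sets M"
    using \<gamma>x(2) Hausdorff
    by (simp add: sets closedin_imp_sets_borel_of closedin_Hausdorff_singleton points_def)
  have "compactin (sp_top X) {x}"
    using \<gamma>x(2) by (simp add: points_def)
  then have fin: "emeasure M {x} < \<infinity>"
    using radon[OF z] unfolding radon_measure_def M_def by blast
  have outer: "emeasure M {x} = (INF V\<in>{V. openin (sp_top X) V \<and> {x} \<subseteq> V}. emeasure M V)"
    using radon[OF z] x_sets unfolding radon_measure_def M_def by blast
  have d0: "0 \<le> d"
    using nonneg fib xfib by (simp add: d_def)
  obtain N where N: "openin ?Q N" "(w, x) \<in> N"
    and test: "\<And>\<phi> K. \<lbrakk>continuous_map ?Q euclideanreal \<phi>; \<phi> (w, x) = 1;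
        compactin ?Q K; K \<subseteq> N; \<And>q. q \<notin> K \<Longrightarrow> \<phi> q = 0\<rbrakk>
      \<Longrightarrow> (LINT y:sfibre X z|M. \<phi> (w, y) * D (w, y)) = 1"
    using local_test_identity[OF iii \<gamma>x] unfolding w_def z_def M_def by blast
  have bump: "\<exists>\<phi>. continuous_map ?Q euclideanreal \<phi> \<and> \<phi> (w, x) = 1 \<and> (\<forall>q. 0 \<le> \<phi> q \<and> \<phi> q \<le> 1) \<and>
      (\<forall>q. q \<notin> N' \<longrightarrow> \<phi> q = 0) \<and>
      has_bochner_integral M (\<lambda>y. indicator (sfibre X z) y * (\<phi> (w, y) * D (w, y))) 1"
    if N': "openin ?Q N'" "(w, x) \<in> N'" "N' \<subseteq> N" for N'
  proof -
    obtain \<phi> :: "_ \<Rightarrow> real" and K where \<phi>: "continuous_map ?Q euclideanreal \<phi>" "\<phi> (w, x) = 1"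
        "\<And>q. 0 \<le> \<phi> q" "\<And>q. \<phi> q \<le> 1" "compactin ?Q K" "K \<subseteq> N'" "\<And>q. q \<notin> K \<Longrightarrow> \<phi> q = 0"
      using bump_function[OF locally_compact_XX Hausdorff_XX N'(1,2)] by blast
    have "(LINT y|M. indicator (sfibre X z) y * (\<phi> (w, y) * D (w, y))) = 1"
      using test[OF \<phi>(1,2,5) _ \<phi>(7)] \<phi>(6) N'(3) by (simp add: set_lebesgue_integral_def)
    \<comment> \<open>The integral is nonzero, and non-integrable functions have integral 0 by convention.\<close>
    moreover from this have "integrable M (\<lambda>y. indicator (sfibre X z) y * (\<phi> (w, y) * D (w, y)))"
      by (rule contrapos_pp) (simp add: not_integrable_integral_eq)
    ultimately have "has_bochner_integral M (\<lambda>y. indicator (sfibre X z) y * (\<phi> (w, y) * D (w, y))) 1"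
      by (simp add: has_bochner_integral_iff)
    then show ?thesis
      using \<phi> by blast
  qed
  \<comment> \<open>For a bump supported where \<open>D < d + \<epsilon>\<close> and \<open>y \<in> V\<close>, the integral is at most \<open>(d + \<epsilon>) \<lambda>\<^sub>z(V)\<close>;
     the infimum over \<open>V\<close> is the mass of \<open>x\<close>.\<close>
  have upper: "1 \<le> (d + \<epsilon>) * measure M {x}" if \<epsilon>: "0 < \<epsilon>" for \<epsilon>
  proof -
    have c: "0 < d + \<epsilon>"
      using d0 \<epsilon> by simp
    have "ennreal (1 / (d + \<epsilon>)) \<le> emeasure M V" if V: "openin (sp_top X) V" "{x} \<subseteq> V" for V
    proof -
      let ?N = "N \<inter> {q \<in> topspace ?Q. D q \<in> {..<d + \<epsilon>}} \<inter> {q \<in> topspace ?Q. snd q \<in> V}"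
      have "continuous_map ?Q (sp_top X) snd"
        unfolding XX_top_def fibre_product_def
        by (rule continuous_map_from_subtopology[OF continuous_map_snd])
      then have "openin ?Q {q \<in> topspace ?Q. snd q \<in> V}"
        using V(1) openin_continuous_map_preimage by blast
      moreover have "openin ?Q {q \<in> topspace ?Q. D q \<in> {..<d + \<epsilon>}}"
        by (rule openin_continuous_map_preimage[OF cont]) simp
      ultimately have "openin ?Q ?N"
        using N(1) by blast
      moreover have "(w, x) \<in> ?N"
        using N(2) V(2) \<epsilon> fib xfib by (simp add: d_def)
      ultimately obtain \<phi> where \<phi>: "\<forall>q. 0 \<le> \<phi> q \<and> \<phi> q \<le> 1" "\<forall>q. q \<notin> ?N \<longrightarrow> \<phi> q = 0"
          and int: "has_bochner_integral M (\<lambda>y. indicator (sfibre X z) y * (\<phi> (w, y) * D (w, y))) 1"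
        using bump[of ?N] by blast
      let ?g = "\<lambda>y. indicator (sfibre X z) y * (\<phi> (w, y) * D (w, y))"
      have g0: "0 \<le> ?g y" for y
        using \<phi>(1) nonneg fib by (auto split: split_indicator)
      have le: "?g y \<le> (d + \<epsilon>) * indicator V y" for y
      proof (cases "y \<in> sfibre X z \<and> \<phi> (w, y) \<noteq> 0")
        case True
        then have "(w, y) \<in> ?N"
          using \<phi>(2) by blast
        then have "y \<in> V" "0 \<le> D (w, y)" "D (w, y) \<le> d + \<epsilon>"
          using nonneg by auto
        moreover have "\<phi> (w, y) * D (w, y) \<le> 1 * D (w, y)"
          by (rule mult_right_mono) (use \<phi>(1) calculation in auto)
        ultimately show ?thesis
          by (auto split: split_indicator)
      next
        case False
        then show ?thesis
          using c by (auto split: split_indicator)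
      qed
      have "1 = (\<integral>\<^sup>+ y. ennreal (?g y) \<partial>M)"
        using nn_integral_eq_integral[of M ?g] int g0
        by (simp add: has_bochner_integral_iff)
      also have "\<dots> \<le> (\<integral>\<^sup>+ y. ennreal (d + \<epsilon>) * indicator V y \<partial>M)"
      proof (rule nn_integral_mono)
        show "ennreal (?g y) \<le> ennreal (d + \<epsilon>) * indicator V y" for y
          using ennreal_leI[OF le[of y]] by (auto split: split_indicator_asm split_indicator)
      qed
      also have "\<dots> = ennreal (d + \<epsilon>) * emeasure M V"
        by (rule nn_integral_cmult_indicator[OF open_sets[OF V(1)]])
      finally have "1 \<le> ennreal (d + \<epsilon>) * emeasure M V" .
      then show ?thesis
      proof (cases "emeasure M V")
        case (real r)
        then have "1 \<le> (d + \<epsilon>) * r"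
          using \<open>1 \<le> ennreal (d + \<epsilon>) * emeasure M V\<close> c
          by (simp add: ennreal_mult[symmetric] flip: ennreal_1)
        then show ?thesis
          using c real by (auto intro!: ennreal_leI simp: field_simps)
      qed simp
    qed
    then have "ennreal (1 / (d + \<epsilon>)) \<le> emeasure M {x}"
      unfolding outer by (intro INF_greatest) auto
    also have "\<dots> = ennreal (measure M {x})"
      using fin by (simp add: emeasure_eq_ennreal_measure less_top)
    finally have "1 / (d + \<epsilon>) \<le> measure M {x}"
      by (simp add: ennreal_le_iff)
    then show ?thesis
      using c by (simp add: field_simps)
  qed
  have lower: "1 \<le> d * measure M {x}"
  proof (rule field_le_epsilon)
    fix e :: real assume e: "0 < e"
    let ?\<mu> = "measure M {x}"
    \<comment> \<open>The summand 1 only guards against division by zero; the error is at most \<open>e\<close>.\<close>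
    have "1 \<le> (d + e / (?\<mu> + 1)) * ?\<mu>"
      by (rule upper) (use e in \<open>simp add: add_nonneg_pos\<close>)
    also have "\<dots> = d * ?\<mu> + e * (?\<mu> / (?\<mu> + 1))"
      by (simp add: algebra_simps)
    also have "\<dots> \<le> d * ?\<mu> + e * 1"
    proof (intro add_left_mono mult_left_mono)
      show "?\<mu> / (?\<mu> + 1) \<le> 1"
        by (subst divide_le_eq_1_pos) (simp_all add: add_nonneg_pos)
    qed (use e in simp)
    finally show "1 \<le> d * ?\<mu> + e" by simp
  qed
  obtain \<phi> where \<phi>: "continuous_map ?Q euclideanreal \<phi>" "\<phi> (w, x) = 1" "\<forall>q. 0 \<le> \<phi> q \<and> \<phi> q \<le> 1"
      and int: "has_bochner_integral M (\<lambda>y. indicator (sfibre X z) y * (\<phi> (w, y) * D (w, y))) 1"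
    using bump[OF N] by blast
  let ?g = "\<lambda>y. indicator (sfibre X z) y * (\<phi> (w, y) * D (w, y))"
  \<comment> \<open>The part of the integrand left over after the atom at \<open>x\<close> is removed.\<close>
  define r where "r = (\<lambda>y. ?g y - d * indicator {x} y)"
  have "has_bochner_integral M (\<lambda>y. d * indicator {x} y) (d * measure M {x})"
    using x_sets fin by (intro has_bochner_integral_mult_right has_bochner_integral_real_indicator)
  then have r_int: "has_bochner_integral M r (1 - d * measure M {x})"
    unfolding r_def by (intro has_bochner_integral_diff int)
  have gx: "?g x = d"
    using xfib \<phi>(2) by (simp add: d_def)
  have g0: "0 \<le> ?g y" for y
    using \<phi>(3) nonneg fib by (auto split: split_indicator)
  have r0: "0 \<le> r y" for y
    using g0[of y] gx by (cases "y = x") (auto simp: r_def)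
  have "0 \<le> 1 - d * measure M {x}"
    unfolding has_bochner_integral_integral_eq[OF r_int, symmetric]
    by (rule Bochner_Integration.integral_nonneg) (rule r0)
  then have eq: "d * measure M {x} = 1"
    using lower by simp
  then show "D (lact X \<gamma> x, x) * measure (lam (rmom X x)) {x} = 1"
    by (simp add: d_def M_def w_def z_def)
  have dpos: "0 < d"
    using eq d0 by (cases "d = 0") auto
  have r_AE: "AE y in M. r y = 0"
    using integral_nonneg_eq_0_iff_AE[of M r] r_int eq r0 by (simp add: has_bochner_integral_iff)
  \<comment> \<open>The set where \<open>\<phi>(w, y) D(w, y) > 0\<close> is only open in the fibre over \<open>z\<close>; it is enlarged to an open
     set \<open>V\<close> of \<open>X\<close>, which costs nothing as the complement of the fibre is null.\<close>
  have "openin ?Q {q \<in> topspace ?Q. \<phi> q * D q \<in> {0<..}}"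
    by (rule openin_continuous_map_preimage[of _ euclideanreal])
      (use \<phi>(1) cont in \<open>auto intro!: continuous_intros\<close>)
  then obtain W where W: "openin (prod_topology (sp_top X) (sp_top X)) W"
      "{q \<in> topspace ?Q. \<phi> q * D q \<in> {0<..}} = W \<inter> {(a, b). rmom X a = rmom X b}"
    unfolding XX_top_def fibre_product_def openin_subtopology by blast
  define V where "V = {y \<in> topspace (sp_top X). (w, y) \<in> W}"
  have "continuous_map (sp_top X) (prod_topology (sp_top X) (sp_top X)) (\<lambda>y. (w, y))"
    using w(1) by (simp add: continuous_map_pairwise o_def points_def)
  then have Vo: "openin (sp_top X) V"
    unfolding V_def using W(1) by (rule openin_continuous_map_preimage)
  have "(w, x) \<in> {q \<in> topspace ?Q. \<phi> q * D q \<in> {0<..}}"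
    using fib xfib \<phi>(2) dpos by (simp add: d_def)
  then have xV: "x \<in> V"
    using W(2) \<gamma>x(2) by (auto simp: V_def points_def)
  have "points X - sfibre X z \<in> null_sets M"
  proof (rule null_setsI)
    show "emeasure M (points X - sfibre X z) = 0"
      using off_fibre_null[OF z] by (simp add: M_def)
    show "points X - sfibre X z \<in> sets M"
      using open_sets closedin_sfibre[OF z] unfolding points_def by blast
  qed
  then have "AE y in M. y \<notin> points X - sfibre X z"
    by (rule AE_not_in)
  then have "AE y in M. \<not> (y \<in> V - {x})"
    using r_AE
  proof eventually_elim
    case (elim y)
    show ?case
    proof
      assume y: "y \<in> V - {x}"
      then have "y \<in> sfibre X z"
        using elim(1) by (auto simp: V_def points_def)
      then have "(w, y) \<in> W \<inter> {(a, b). rmom X a = rmom X b}"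
        using y w by (auto simp: V_def sfibre_def)
      then have "0 < \<phi> (w, y) * D (w, y)"
        unfolding W(2)[symmetric] by simp
      then show False
        using elim(2) y \<open>y \<in> sfibre X z\<close> by (simp add: r_def)
    qed
  qed
  then have "emeasure M {y \<in> space M. y \<in> V - {x}} = 0"
    by (rule emeasure_eq_0_AE)
  moreover have "{y \<in> space M. y \<in> V - {x}} = V - {x}"
    by (auto simp: space V_def points_def)
  ultimately show "\<exists>V. openin (sp_top X) V \<and> x \<in> V \<and> emeasure (lam (rmom X x)) (V - {x}) = 0"
    using Vo xV unfolding M_def z_def by auto
qed

end

theorem lemma3p19:
  fixes G :: "'g groupoid" and H :: "'h groupoid"
    and X :: "('g, 'h, 'x) bispace" and lam :: "'h \<Rightarrow> 'x measure"
  assumes "etale_groupoid G" and "etale_groupoid H"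
    and "proper_correspondence G (counting_haar G) H X lam"
  shows "(\<forall>z\<in>units H. atomic_measure (lam z)) \<and>
    (\<forall>z\<in>units H. \<forall>x\<in>sfibre X z. emeasure (lam z) {x} \<noteq> 0) \<and>
    (\<forall>D. properness_function G (counting_haar G) H X lam D \<longrightarrow>
       (\<forall>p\<in>topspace (GX_top G X). 0 < D (m_map X p))) \<and>
    full_support H X lam"
proof -
  interpret etale_correspondence G H X lam
    using assms unfolding proper_correspondence_def
    by (intro etale_correspondence.intro etale_correspondence_axioms.intro) auto
  have mass: "D (lact X \<gamma> x, x) * measure (lam (rmom X x)) {x} = 1"
      "\<exists>V. openin (sp_top X) V \<and> x \<in> V \<and> emeasure (lam (rmom X x)) (V - {x}) = 0"
    if "properness_function G (counting_haar G) H X lam D"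
      "\<gamma> \<in> arrows G" "x \<in> points X" "src G \<gamma> = lmom X x" for D \<gamma> x
    using that point_mass[of D \<gamma> x] unfolding properness_function_def by blast+
  obtain D where D: "properness_function G (counting_haar G) H X lam D"
    using assms(3) unfolding proper_correspondence_def by blast
  have atom: "emeasure (lam z) {x} \<noteq> 0"
      "\<exists>V. openin (sp_top X) V \<and> x \<in> V \<and> emeasure (lam z) (V - {x}) = 0"
    if "x \<in> sfibre X z" for x z
  proof -
    have x: "x \<in> points X" "rmom X x = z"
      using that by (auto simp: sfibre_def)
    have u: "lmom X x \<in> arrows G" "src G (lmom X x) = lmom X x"
      using lmom_unit[OF x(1)] unit_arrow G.src_of_unit by auto
    show "emeasure (lam z) {x} \<noteq> 0"
      using mass(1)[OF D u(1) x(1) u(2)] x(2) by (auto simp: measure_def)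
    show "\<exists>V. openin (sp_top X) V \<and> x \<in> V \<and> emeasure (lam z) (V - {x}) = 0"
      using mass(2)[OF D u(1) x(1) u(2)] x(2) by simp
  qed
  have off: "openin (sp_top X) (points X - sfibre X z)" if "z \<in> units H" for z
    using closedin_sfibre[OF that] unfolding points_def by blast
  have "atomic_measure (lam z)" if z: "z \<in> units H" for z
  proof (rule radon_isolated_atoms_imp_atomic[OF radon[OF z] Hausdorff])
    fix x assume "x \<in> topspace (sp_top X)"
    show "\<exists>V. openin (sp_top X) V \<and> x \<in> V \<and> emeasure (lam z) (V - {x}) = 0"
    proof (cases "x \<in> sfibre X z")
      case True
      then show ?thesis by (rule atom(2))
    next
      case False
      have "points X - sfibre X z \<in> sets (lam z)"
        using off[OF z] by (simp add: sets_lam[OF z] openin_imp_sets_borel_of)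
      then have "emeasure (lam z) (points X - sfibre X z - {x}) \<le> emeasure (lam z) (points X - sfibre X z)"
        by (intro emeasure_mono) auto
      then have "emeasure (lam z) (points X - sfibre X z - {x}) = 0"
        using off_fibre_null[OF z] by simp
      then show ?thesis
        using False off[OF z] \<open>x \<in> topspace (sp_top X)\<close>
        by (intro exI[of _ "points X - sfibre X z"]) (auto simp: points_def)
    qed
  qed
  moreover have "0 < D' (m_map X p)"
    if D': "properness_function G (counting_haar G) H X lam D'" and p: "p \<in> topspace (GX_top G X)"
    for D' p
  proof -
    obtain \<gamma> x where p': "p = (\<gamma>, x)" "\<gamma> \<in> arrows G" "x \<in> points X" "src G \<gamma> = lmom X x"
      using p by (auto simp: topspace_GX)
    have "D' (lact X \<gamma> x, x) * measure (lam (rmom X x)) {x} > 0"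
      using mass(1)[OF D' p'(2-4)] by simp
    then show ?thesis
      by (simp add: p' m_map_def zero_less_mult_iff not_less[symmetric])
  qed
  moreover have "supp_measure (sp_top X) (lam z) = sfibre X z" if z: "z \<in> units H" for z
  proof (intro equalityI subsetI)
    fix x assume x: "x \<in> supp_measure (sp_top X) (lam z)"
    show "x \<in> sfibre X z"
      using x off[OF z] off_fibre_null[OF z] unfolding supp_measure_def points_def by blast
  next
    fix x assume x: "x \<in> sfibre X z"
    have "emeasure (lam z) V \<noteq> 0" if V: "openin (sp_top X) V" "x \<in> V" for V
    proof -
      have "emeasure (lam z) {x} \<le> emeasure (lam z) V"
        using V by (intro emeasure_mono) (auto simp: sets_lam[OF z] openin_imp_sets_borel_of)
      then show ?thesis
        using atom(1)[OF x] by auto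
    qed
    then show "x \<in> supp_measure (sp_top X) (lam z)"
      using x unfolding supp_measure_def sfibre_def points_def by blast
  qed
  ultimately show ?thesis
    using atom(1) unfolding full_support_def by blast
qed

end
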